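(* Let $m,n\ge 1$ and let $G=K_{m,n}\setminus M$, where $M$ is a matching of size $t$ in $K_{m,n}$. Then $\operatorname{fp}(G)=1$ if $t\le 1$, and $\operatorname{fp}(G)=2$ if $t\ge 2$.
   Context: A bipartite graph is a Ferrers graph if it contains no induced copy of $2K_2$ (two disjoint edges with no other edges among their four endpoints); equivalently, the neighborhoods on one side are totally ordered by inclusion. For a bipartite graph $G=(U,V,E)$, $\operatorname{fp}(G)$ is the minimum $k$ such that $E$ can be partitioned into $k$ sets $E_i$ with each spanning subgraph $(U,V,E_i)$ a Ferrers graph. $K_{m,n}\setminus M$ is the complete bipartite graph with the edges of $M$ deleted, keeping the same bipartition. *)

theory Defs
  imports Main "HOL-Library.Disjoint_Sets"
begin

text \<open>
  A bipartite graph comes with its bipartition. The two sides live in separate types, hence are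
  disjoint, and the edge \<open>uv\<close> is the pair \<open>(u, v)\<close> with \<open>u\<close> on the left and \<open>v\<close> on the right.
\<close>

record ('a, 'b) bigraph =
  lverts :: "'a set"
  rverts :: "'b set"
  edges :: "('a \<times> 'b) set"

definition bipartite_graph :: "('a, 'b) bigraph \<Rightarrow> bool" where
  "bipartite_graph G \<longleftrightarrow> edges G \<subseteq> lverts G \<times> rverts G"

text \<open>
  Two disjoint edges \<open>uv\<close> and \<open>u'v'\<close> such that neither of the two other left-right pairs among
  their endpoints is an edge; pairs on the same side are never edges.
\<close>

definition has_induced_2K2 :: "('a, 'b) bigraph \<Rightarrow> bool" where
  "has_induced_2K2 G \<longleftrightarrow>
     (\<exists>u v u' v'. (u, v) \<in> edges G \<and> (u', v') \<in> edges G \<and> u \<noteq> u' \<and> v \<noteq> v' \<and>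
        (u, v') \<notin> edges G \<and> (u', v) \<notin> edges G)"

definition ferrers_graph :: "('a, 'b) bigraph \<Rightarrow> bool" where
  "ferrers_graph G \<longleftrightarrow> bipartite_graph G \<and> \<not> has_induced_2K2 G"

text \<open>
  The parts may be empty. For a graph with at least one edge this does not affect the minimum
  below.
\<close>

definition ferrers_partition :: "('a, 'b) bigraph \<Rightarrow> nat \<Rightarrow> (nat \<Rightarrow> ('a \<times> 'b) set) \<Rightarrow> bool" where
  "ferrers_partition G k F \<longleftrightarrow>
     disjoint_family_on F {..<k} \<and> (\<Union>i<k. F i) = edges G \<and>
     (\<forall>i<k. ferrers_graph (G\<lparr>edges := F i\<rparr>))"

text \<open>
  The number of parts is at least 1, so an edgeless graph, which is itself a Ferrers graph,
  has value 1. For a finite bipartite graph the minimum exists, as single edges form Ferrers graphs.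
\<close>

definition fp :: "('a, 'b) bigraph \<Rightarrow> nat" where
  "fp G = (LEAST k. k \<ge> 1 \<and> (\<exists>F. ferrers_partition G k F))"

definition complete_bipartite :: "'a set \<Rightarrow> 'b set \<Rightarrow> ('a, 'b) bigraph" where
  "complete_bipartite U V = \<lparr>lverts = U, rverts = V, edges = U \<times> V\<rparr>"

definition matching :: "('a, 'b) bigraph \<Rightarrow> ('a \<times> 'b) set \<Rightarrow> bool" where
  "matching G M \<longleftrightarrow>
     M \<subseteq> edges G \<and> (\<forall>e\<in>M. \<forall>f\<in>M. e \<noteq> f \<longrightarrow> fst e \<noteq> fst f \<and> snd e \<noteq> snd f)"

definition delete_edges :: "('a, 'b) bigraph \<Rightarrow> ('a \<times> 'b) set \<Rightarrow> ('a, 'b) bigraph" where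
  "delete_edges G M = G\<lparr>edges := edges G - M\<rparr>"

end

theory Submission
  imports Defs
begin

text \<open>
  Label the left vertices injectively by positive integers, give each matched right vertex the label
  of its partner, and give all other right vertices the label 0. Then \<open>M\<close> consists of the pairs with
  equal labels, so the edges of \<open>G\<close> split into those with smaller left label and those with smaller
  right label. Both parts are threshold graphs, hence Ferrers graphs. Conversely, the endpoints of
  two edges of \<open>M\<close> induce a \<open>2K\<^sub>2\<close> in \<open>G\<close>, and the non-edges of any induced \<open>2K\<^sub>2\<close> lie in \<open>M\<close>.
\<close>

text \<open>An induced 2K2 in the first graph would give the cycle
  \<open>a u < b v \<le> a u' < b v' \<le> a u\<close>: its two edges already place all four
  endpoints in \<open>U\<close> and \<open>V\<close>, so a missing pair can only fail the
  inequality. The second graph gives the reversed cycle.\<close>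

lemma ferrers_graph_threshold:
  fixes a :: "'a \<Rightarrow> 'c::linorder"
  shows "ferrers_graph \<lparr>lverts = U, rverts = V, edges = {(u, v) \<in> U \<times> V. a u < b v}\<rparr>"
      (is "ferrers_graph ?G")
    and "ferrers_graph \<lparr>lverts = U, rverts = V, edges = {(u, v) \<in> U \<times> V. b v < a u}\<rparr>"
      (is "ferrers_graph ?H")
proof -
  have False if "a u < b v" "a u' < b v'" "\<not> a u < b v'" "\<not> a u' < b v" for u u' v v'
    using that by order
  then have "\<not> has_induced_2K2 ?G"
    unfolding has_induced_2K2_def by (simp, blast)
  then show "ferrers_graph ?G"
    by (auto simp: ferrers_graph_def bipartite_graph_def)
  have False if "b v < a u" "b v' < a u'" "\<not> b v' < a u" "\<not> b v < a u'" for u u' v v'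
    using that by order
  then have "\<not> has_induced_2K2 ?H"
    unfolding has_induced_2K2_def by (simp, blast)
  then show "ferrers_graph ?H"
    by (auto simp: ferrers_graph_def bipartite_graph_def)
qed

lemma delete_edges_complete_bipartite:
  "delete_edges (complete_bipartite U V) M = \<lparr>lverts = U, rverts = V, edges = U \<times> V - M\<rparr>"
  by (simp add: delete_edges_def complete_bipartite_def)

lemma matching_labels:
  assumes "finite U" and "matching (complete_bipartite U V) M"
  obtains a :: "'a \<Rightarrow> nat" and b :: "'b \<Rightarrow> nat"
  where "M = {(u, v) \<in> U \<times> V. a u = b v}"
proof -
  obtain p :: "'a \<Rightarrow> nat" where p: "inj_on p U"
    using finite_imp_inj_to_nat_seg[OF \<open>finite U\<close>] by blast
  have unique: "u = u'" if "(u, v) \<in> M" "(u', v) \<in> M" for u u' v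
    using assms(2) that unfolding matching_def complete_bipartite_def by fastforce
  have M_sub: "M \<subseteq> U \<times> V"
    using assms(2) by (simp add: matching_def complete_bipartite_def)
  \<comment> \<open>\<open>Suc\<close> keeps 0 free for the unmatched right vertices, so their label
    equals no left label. The description is well defined by \<open>unique\<close>.\<close>
  define b where "b v = (if \<exists>u. (u, v) \<in> M then Suc (p (THE u. (u, v) \<in> M)) else 0)" for v
  have b: "b v = Suc (p u)" if "(u, v) \<in> M" for u v
  proof -
    have "(THE u. (u, v) \<in> M) = u"
      using that unique by blast
    with that show ?thesis
      by (auto simp: b_def)
  qed
  \<comment> \<open>A nonzero label means that \<open>v\<close> has some partner \<open>u'\<close>;
    injectivity of \<open>p\<close> on \<open>U\<close> then identifies \<open>u'\<close> with
    \<open>u\<close>.\<close>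
  have "(u, v) \<in> M" if u: "u \<in> U" and eq: "Suc (p u) = b v" for u v
  proof -
    obtain u' where "(u', v) \<in> M"
      using eq by (metis b_def nat.distinct(1))
    moreover from this have "u' = u"
      using b u eq p M_sub by (metis SigmaD1 Suc_inject inj_onD subsetD)
    ultimately show ?thesis by simp
  qed
  then have "M = {(u, v) \<in> U \<times> V. Suc (p u) = b v}"
    using M_sub b by auto
  then show thesis
    by (rule that[of "\<lambda>u. Suc (p u)" b])
qed

text \<open>A single part has to be the whole edge set. This settles the value 1 and supplies the
  lower bound in \<open>fp_eq_2\<close>.\<close>

lemma ferrers_partition_1_iff:
  "(\<exists>F. ferrers_partition G 1 F) \<longleftrightarrow> ferrers_graph G"
proof
  assume "ferrers_graph G"
  then have "ferrers_partition G 1 (\<lambda>_. edges G)"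
    by (simp add: ferrers_partition_def disjoint_family_on_def lessThan_Suc)
  then show "\<exists>F. ferrers_partition G 1 F" by blast
next
  assume "\<exists>F. ferrers_partition G 1 F"
  then obtain F where "F 0 = edges G" and "ferrers_graph (G\<lparr>edges := F 0\<rparr>)"
    unfolding ferrers_partition_def by (auto simp: lessThan_Suc)
  then show "ferrers_graph G" by simp
qed

lemma fp_eq_1:
  assumes "ferrers_graph G"
  shows "fp G = 1"
  unfolding fp_def using assms ferrers_partition_1_iff[of G]
  by (intro Least_equality) auto

lemma fp_eq_2:
  assumes "\<not> ferrers_graph G" and "ferrers_partition G 2 F"
  shows "fp G = 2"
  unfolding fp_def
proof (rule Least_equality)
  fix k
  assume "1 \<le> k \<and> (\<exists>F. ferrers_partition G k F)"
  moreover from this have "k \<noteq> 1"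
    using assms(1) ferrers_partition_1_iff by blast
  ultimately show "2 \<le> k" by linarith
qed (use assms(2) in auto)

lemma ferrers_partition_delete_matching:
  assumes "finite U" and "matching (complete_bipartite U V) M"
  shows "\<exists>F. ferrers_partition (delete_edges (complete_bipartite U V) M) 2 F"
proof -
  obtain a :: "'a \<Rightarrow> nat" and b where M: "M = {(u, v) \<in> U \<times> V. a u = b v}"
    using matching_labels[OF assms] .
  define P where "P = {(u, v) \<in> U \<times> V. a u < b v}"
  define Q where "Q = {(u, v) \<in> U \<times> V. b v < a u}"
  define F where "F i = (if i = 0 then P else Q)" for i :: nat
  have two: "{..<2} = {0, 1 :: nat}" by auto
  \<comment> \<open>Trichotomy of the labels: the pairs of \<open>U \<times> V\<close> in neither
    part are those with equal labels, that is, \<open>M\<close>.\<close>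
  have "P \<inter> Q = {}" "P \<union> Q = U \<times> V - M"
    unfolding P_def Q_def M by auto
  then have "disjoint_family_on F {..<2}" "(\<Union>i<2. F i) = U \<times> V - M"
    unfolding disjoint_family_on_def two F_def by (simp_all add: Int_commute Un_commute)
  moreover have "ferrers_graph \<lparr>lverts = U, rverts = V, edges = F i\<rparr>" for i
    using ferrers_graph_threshold unfolding F_def P_def Q_def by (cases "i = 0") simp_all
  ultimately have "ferrers_partition (delete_edges (complete_bipartite U V) M) 2 F"
    by (simp add: ferrers_partition_def delete_edges_complete_bipartite)
  then show ?thesis by blast
qed

lemma ferrers_graph_delete_matching_iff:
  assumes "finite M" and "matching (complete_bipartite U V) M"
  shows "ferrers_graph (delete_edges (complete_bipartite U V) M) \<longleftrightarrow> card M \<le> 1"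
proof
  assume ferrers: "ferrers_graph (delete_edges (complete_bipartite U V) M)"
  have M: "M \<subseteq> U \<times> V"
    and disj: "\<And>e f. e \<in> M \<Longrightarrow> f \<in> M \<Longrightarrow> e \<noteq> f \<Longrightarrow> fst e \<noteq> fst f \<and> snd e \<noteq> snd f"
    using assms(2) by (auto simp: matching_def complete_bipartite_def)
  have "e = f" if "e \<in> M" "f \<in> M" for e f
  proof (rule ccontr)
    assume "e \<noteq> f"
    obtain u v u' v' where ef: "e = (u, v)" "f = (u', v')" by fastforce
    have ne: "u \<noteq> u'" "v \<noteq> v'"
      using disj[OF that \<open>e \<noteq> f\<close>] ef by auto
    \<comment> \<open>Each cross pair shares an endpoint with \<open>e\<close> and differs from
      \<open>e\<close>, so it cannot lie in the matching. The cross pairs are thus the two edges of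
      the induced 2K2, and \<open>e\<close> and \<open>f\<close> are its missing pairs.\<close>
    have "(u, v') \<in> U \<times> V - M" "(u', v) \<in> U \<times> V - M"
      using M that disj[of e "(u, v')"] disj[of e "(u', v)"] ef ne by auto
    moreover have "(u, v) \<notin> U \<times> V - M" "(u', v') \<notin> U \<times> V - M"
      using that ef by auto
    ultimately have "has_induced_2K2 (delete_edges (complete_bipartite U V) M)"
      unfolding has_induced_2K2_def delete_edges_complete_bipartite bigraph.simps
      using ne by metis
    then show False
      using ferrers by (simp add: ferrers_graph_def)
  qed
  then show "card M \<le> 1"
    by (simp add: card_le_Suc0_iff_eq[OF assms(1)])
next
  assume "card M \<le> 1"
  then have "\<forall>e\<in>M. \<forall>f\<in>M. e = f"
    by (simp add: card_le_Suc0_iff_eq[OF assms(1)])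
  \<comment> \<open>The two missing pairs of an induced 2K2 lie in \<open>U \<times> V\<close>,
    hence in \<open>M\<close>; they have different left ends, so \<open>M\<close> would have two
    elements.\<close>
  then show "ferrers_graph (delete_edges (complete_bipartite U V) M)"
    unfolding ferrers_graph_def bipartite_graph_def has_induced_2K2_def
      delete_edges_complete_bipartite by auto
qed

theorem theorem6p5:
  fixes U :: "'a set" and V :: "'b set" and M :: "('a \<times> 'b) set" and m n t :: nat
  assumes "m \<ge> 1" and "n \<ge> 1"
    and "card U = m" and "card V = n"
    and "matching (complete_bipartite U V) M" and "card M = t"
  shows "(t \<le> 1 \<longrightarrow> fp (delete_edges (complete_bipartite U V) M) = 1) \<and>
         (t \<ge> 2 \<longrightarrow> fp (delete_edges (complete_bipartite U V) M) = 2)"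
proof -
  \<comment> \<open>Infinite sets have \<open>card\<close> 0, so positive cardinality forces
    finiteness.\<close>
  have "finite U" "finite V"
    using assms(1-4) by (auto intro: card_ge_0_finite)
  moreover have "M \<subseteq> U \<times> V"
    using assms(5) by (simp add: matching_def complete_bipartite_def)
  ultimately have "finite M"
    by (meson finite_SigmaI finite_subset)
  note iff = ferrers_graph_delete_matching_iff[OF this assms(5)]
  obtain F where "ferrers_partition (delete_edges (complete_bipartite U V) M) 2 F"
    using ferrers_partition_delete_matching[OF \<open>finite U\<close> assms(5)] ..
  then show ?thesis
    using iff assms(6) by (simp add: fp_eq_1 fp_eq_2)
qed

end
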